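(* Let $\alpha>0$, $\mu\in\mathbb{R}$, $\sigma>0$, and let $X\sim GGD(\mu,\sigma,\alpha)$. Then for every real $t\neq 0$ the characteristic function of $X$ is $$\varphi_\alpha(t)=\mathbb{E}[e^{itX}]=\frac{\sqrt{\pi}}{\Gamma(1/\alpha)}\,e^{it\mu}\,{\rm H}^{1,1}_{1,2}\!\left[\frac{\sigma^2\Gamma(1/\alpha)}{4\Gamma(3/\alpha)}\,t^2\ \middle|\ \begin{matrix}(1-\tfrac1\alpha,\tfrac2\alpha)\\(0,1),(\tfrac12,1)\end{matrix}\right],$$ that is, $$\varphi_\alpha(t)=\frac{\sqrt{\pi}}{\Gamma(1/\alpha)}\,e^{it\mu}\,\frac{1}{2\pi i}\int_{L}\frac{\Gamma(s)\,\Gamma\!\left(\frac{1}{\alpha}-\frac{2s}{\alpha}\right)}{\Gamma\!\left(\frac12-s\right)}\left(\frac{\sigma^2\Gamma(1/\alpha)}{4\Gamma(3/\alpha)}t^2\right)^{-s}ds .$$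
   Context: For $\alpha>0$, $\mu\in\mathbb{R}$, $\sigma>0$, a random variable $X\sim GGD(\mu,\sigma,\alpha)$ (generalized Gaussian) has density $f_X(x)=\frac{\alpha\Lambda}{2\Gamma(1/\alpha)}\exp(-\Lambda^\alpha|x-\mu|^\alpha)$, $x\in\mathbb{R}$, where $\Lambda=\frac{1}{\sigma}\sqrt{\Gamma(3/\alpha)/\Gamma(1/\alpha)}$; it has mean $\mu$ and variance $\sigma^2$. The Fox H-function is defined by the Mellin–Barnes integral ${\rm H}^{m,n}_{p,q}\!\left[z\,\middle|\,\begin{matrix}(a_1,A_1),\dots,(a_p,A_p)\\(b_1,B_1),\dots,(b_q,B_q)\end{matrix}\right]=\frac{1}{2\pi i}\int_L\frac{\prod_{j=1}^m\Gamma(b_j+B_js)\prod_{i=1}^n\Gamma(1-a_i-A_is)}{\prod_{j=m+1}^q\Gamma(1-b_j-B_js)\prod_{i=n+1}^p\Gamma(a_i+A_is)}\,z^{-s}\,ds$ (with $A_i,B_j>0$), where $L$ is a suitable contour (as in Kilbas–Saigo, "H-Transforms") separating the poles of the $\Gamma(b_j+B_js)$, $j\le m$, from those of the $\Gamma(1-a_i-A_is)$, $i\le n$. *)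

theory Defs
  imports "HOL-Probability.Probability"
begin

definition ggd_Lambda :: "real \<Rightarrow> real \<Rightarrow> real" where
  "ggd_Lambda \<sigma> \<alpha> = (1 / \<sigma>) * sqrt (Gamma (3 / \<alpha>) / Gamma (1 / \<alpha>))"

definition ggd_density :: "real \<Rightarrow> real \<Rightarrow> real \<Rightarrow> real \<Rightarrow> real" where
  "ggd_density \<mu> \<sigma> \<alpha> x =
     \<alpha> * ggd_Lambda \<sigma> \<alpha> / (2 * Gamma (1 / \<alpha>))
       * exp (- ((ggd_Lambda \<sigma> \<alpha>) powr \<alpha> * \<bar>x - \<mu>\<bar> powr \<alpha>))"

text \<open>Integrand of the Mellin--Barnes integral defining the Fox H-function
  H^{m,n}_{p,q}; the lists aA = [(a_1,A_1),...,(a_p,A_p)] and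
  bB = [(b_1,B_1),...,(b_q,B_q)] (0-based indexing).\<close>

definition fox_H_kernel ::
  "nat \<Rightarrow> nat \<Rightarrow> (real \<times> real) list \<Rightarrow> (real \<times> real) list \<Rightarrow> complex \<Rightarrow> complex" where
  "fox_H_kernel m n aA bB s =
     ((\<Prod>j<m. Gamma (of_real (fst (bB ! j)) + of_real (snd (bB ! j)) * s))
      * (\<Prod>i<n. Gamma (1 - of_real (fst (aA ! i)) - of_real (snd (aA ! i)) * s)))
     / ((\<Prod>j\<in>{m..<length bB}. Gamma (1 - of_real (fst (bB ! j)) - of_real (snd (bB ! j)) * s))
      * (\<Prod>i\<in>{n..<length aA}. Gamma (of_real (fst (aA ! i)) + of_real (snd (aA ! i)) * s)))"

text \<open>Fox H-function at z > 0, with the contour L taken to be the vertical line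
  Re s = c (traversed upwards): (1/(2 pi i)) int_L K(s) z^(-s) ds
  = (1/(2 pi)) int_R K(c + i y) z^(-(c + i y)) dy.\<close>

definition fox_H ::
  "nat \<Rightarrow> nat \<Rightarrow> (real \<times> real) list \<Rightarrow> (real \<times> real) list \<Rightarrow> real \<Rightarrow> real \<Rightarrow> complex" where
  "fox_H m n aA bB c z =
     complex_of_real (1 / (2 * pi)) *
     (LINT y|lborel. fox_H_kernel m n aA bB (Complex c y)
                     * complex_of_real z powr (- Complex c y))"

end

theory Submission
  imports Defs
begin

text \<open>
  After an affine substitution the claim concerns the integral of \<open>exp (- x\<^sup>\<alpha>) cos (\<tau> x)\<close> over
  \<open>x > 0\<close>. Mellin inversion \<open>2 \<pi> exp (- y) = \<integral> \<Gamma>(w) y powr (- w) dv\<close>, \<open>w = d + i v\<close>, is Fourier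
  inversion for \<open>exp (d u - exp u)\<close>. Applying it at \<open>y = x\<^sup>\<alpha>\<close> and replacing the cosine by
  \<open>exp (- p x)\<close> with \<open>Re p > 0\<close>, Fubini's theorem leaves the inner integral
  \<open>\<integral> x powr (w - 1) exp (- p x) dx = \<Gamma>(w) p powr (- w)\<close>. The same formula with
  \<open>p = exp (\<plusminus> i \<theta>)\<close> bounds \<open>\<Gamma>\<close> on vertical lines by \<open>exp (- \<theta> \<bar>v\<bar>)\<close> for each \<open>\<theta> < \<pi> / 2\<close>, which
  justifies letting \<open>p\<close> tend to \<open>\<plusminus> i \<tau>\<close>. Adding the two limits gives the Mellin--Barnes integral with
  \<open>\<Gamma>(2 s) cos (\<pi> s)\<close>, and the duplication and reflection formulas turn this into the quotient
  \<open>\<Gamma>(s) / \<Gamma>(1/2 - s)\<close>. Integrals over \<open>x > 0\<close> are written in the variable \<open>u = ln x\<close>.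
\<close>

section \<open>Euler's Gamma integral in the logarithmic variable\<close>

text \<open>Change of variables along \<open>exp\<close> concerns absolute integrability over
  \<open>lebesgue\<close>; for Borel functions this agrees with Bochner integrability over
  \<open>lborel\<close>. Both directions are used: towards \<open>u\<close> for the Gamma integral,
  towards \<open>x\<close> for integrals over half-lines.\<close>

lemma has_bochner_integral_exp_substitution:
  fixes f :: "real \<Rightarrow> 'a :: euclidean_space"
  assumes [measurable]: "f \<in> borel_measurable borel"
  shows "has_bochner_integral lborel (\<lambda>u. exp u *\<^sub>R f (exp u)) I \<longleftrightarrow>
         has_bochner_integral lborel (\<lambda>x. indicator {0<..} x *\<^sub>R f x) I"
proof -
  have lebesgue_iff: "g absolutely_integrable_on S \<and> integral S g = I \<longleftrightarrow>
      has_bochner_integral lborel (\<lambda>x. indicator S x *\<^sub>R g x) I"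
    if [measurable]: "g \<in> borel_measurable borel" "S \<in> sets borel"
    for g :: "real \<Rightarrow> 'a" and S
  proof -
    have int: "g absolutely_integrable_on S \<longleftrightarrow> integrable lborel (\<lambda>x. indicator S x *\<^sub>R g x)"
      unfolding set_integrable_def by (rule integrable_completion) measurable
    show ?thesis
    proof (cases "g absolutely_integrable_on S")
      case True
      then have "integral S g = (LINT x:S|lebesgue. g x)"
        by (simp add: set_lebesgue_integral_eq_integral)
      also have "\<dots> = (LINT x|lborel. indicator S x *\<^sub>R g x)"
        unfolding set_lebesgue_integral_def by (rule integral_completion) measurable
      finally show ?thesis
        using int True by (simp add: has_bochner_integral_iff)
    qed (simp add: int has_bochner_integral_iff)
  qed
  have "(\<lambda>u. \<bar>exp u\<bar> *\<^sub>R f (exp u)) absolutely_integrable_on UNIV \<and>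
        integral UNIV (\<lambda>u. \<bar>exp u\<bar> *\<^sub>R f (exp u)) = I \<longleftrightarrow>
        f absolutely_integrable_on range exp \<and> integral (range exp) f = I"
    by (rule has_absolute_integral_change_of_variables_real)
       (auto intro!: derivative_eq_intros simp: inj_on_def)
  moreover have "range exp = {0 :: real<..}"
    proof safe
    fix x :: real assume "x > 0"
    then have "x = exp (ln x)" by simp
    then show "x \<in> range exp" by (rule range_eqI)
  qed simp
  ultimately show ?thesis
    by (simp add: lebesgue_iff)
qed

lemma has_bochner_integral_Gamma_exp:
  assumes "Re w > 0"
  shows "has_bochner_integral lborel (\<lambda>u. exp (w * of_real u - of_real (exp u))) (Gamma w)"
proof -
  \<comment> \<open>Written through \<open>ln\<close> and cut off at 0, the Euler integrand is Borel
    on the whole line; \<open>f_eq\<close> identifies it with the usual power for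
    \<open>x > 0\<close>.\<close>
  define f where "f x = (if x > 0 then exp ((w - 1) * of_real (ln x) - of_real x) else 0)" for x :: real
  have [measurable]: "f \<in> borel_measurable borel"
    unfolding f_def by measurable
  have f_eq: "f x = of_real x powr (w - 1) / of_real (exp x)" if "x > 0" for x
    using that by (simp add: f_def powr_def exp_diff exp_of_real Ln_of_real)
  have "f absolutely_integrable_on {0<..}"
    using absolutely_integrable_Gamma_integral'[OF assms]
    by (rule set_integrable_cong[THEN iffD1, rotated -1]) (auto simp: f_eq)
  then have "integrable lebesgue (\<lambda>x. indicator {0<..} x *\<^sub>R f x)"
    by (simp add: set_integrable_def)
  then have int: "set_integrable lborel {0<..} f"
    unfolding set_integrable_def by (subst (asm) integrable_completion) measurable
  have "(f has_integral Gamma w) {0<..}"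
    using Gamma_integral_complex'[OF assms]
    by (rule has_integral_eq[rotated]) (auto simp: f_eq)
  then have "has_bochner_integral lborel (\<lambda>x. indicator {0<..} x *\<^sub>R f x) (Gamma w)"
    using int set_borel_integral_eq_integral(2)[OF int]
    by (simp add: has_bochner_integral_iff set_integrable_def set_lebesgue_integral_def integral_unique)
  then have "has_bochner_integral lborel (\<lambda>u. exp u *\<^sub>R f (exp u)) (Gamma w)"
    by (simp add: has_bochner_integral_exp_substitution)
  also have "(\<lambda>u. exp u *\<^sub>R f (exp u)) = (\<lambda>u. exp (w * of_real u - of_real (exp u)))"
    by (auto simp: f_def scaleR_conv_of_real exp_of_real [symmetric] mult_exp_exp algebra_simps)
  finally show ?thesis .
qed

text \<open>Translating \<open>u\<close> by \<open>ln r\<close> turns \<open>exp u\<close> into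
  \<open>r * exp u\<close> and produces the factor \<open>r powr w\<close>, which is then divided
  out.\<close>

lemma has_bochner_integral_Gamma_exp_rate:
  assumes "Re w > 0" "r > 0"
  shows "has_bochner_integral lborel (\<lambda>u. exp (w * of_real u - of_real (r * exp u)))
           (Gamma w * of_real r powr (-w))"
proof -
  have "has_bochner_integral lborel (\<lambda>u. exp (w * of_real (ln r + 1 * u) - of_real (exp (ln r + 1 * u))))
           (Gamma w /\<^sub>R \<bar>1\<bar>)"
    using has_bochner_integral_Gamma_exp[OF assms(1)]
    by (subst (asm) lborel_has_bochner_integral_real_affine_iff[of 1 _ _ "ln r"]) auto
  then have "has_bochner_integral lborel (\<lambda>u. of_real r powr (-w) *
      exp (w * of_real (ln r + 1 * u) - of_real (exp (ln r + 1 * u)))) (of_real r powr (-w) * Gamma w)"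
    by (intro has_bochner_integral_mult_right) auto
  also have "(\<lambda>u. of_real r powr (-w) *
      exp (w * of_real (ln r + 1 * u) - of_real (exp (ln r + 1 * u)))) =
      (\<lambda>u. exp (w * of_real u - of_real (r * exp u)))"
    using assms(2) by (simp add: powr_def Ln_of_real mult_exp_exp algebra_simps exp_add)
  finally show ?thesis
    by (simp add: mult.commute)
qed

lemma has_bochner_integral_Gamma_exp_rate_real:
  fixes c r :: real
  assumes "c > 0" "r > 0"
  shows "has_bochner_integral lborel (\<lambda>u. exp (c * u - r * exp u)) (Gamma c * r powr (-c))"
proof -
  have "has_bochner_integral lborel (\<lambda>u. complex_of_real (exp (c * u - r * exp u)))
          (of_real (Gamma c * r powr (-c)))"
    using has_bochner_integral_Gamma_exp_rate[of "of_real c" r] assms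
    by (simp add: Gamma_complex_of_real powr_of_real exp_of_real [symmetric] flip: of_real_minus)
  then show ?thesis
    by (simp add: has_bochner_integral_iff complex_of_real_integrable_eq of_real_eq_iff
        del: of_real_mult)
qed

section \<open>Complex rates via the binomial series\<close>

text \<open>The binomial series with exponent \<open>-w\<close>. Pochhammer coefficients are the
  ones that termwise integration produces through
  \<open>Gamma (w + n) = pochhammer w n * Gamma w\<close>.\<close>

lemma pochhammer_series_sums_powr:
  fixes w z :: complex
  assumes "norm z < 1"
  shows "(\<lambda>n. pochhammer w n / fact n * z ^ n) sums (1 - z) powr (-w)"
proof -
  have "(\<lambda>n. ((-w) gchoose n) * (-z) ^ n) sums (1 + (-z)) powr (-w)"
    using assms by (intro gen_binomial_complex) simp
  also have "(\<lambda>n. ((-w) gchoose n) * (-z) ^ n) = (\<lambda>n. pochhammer w n / fact n * z ^ n)"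
  proof
    fix n
    have "(-1) ^ n * (-z) ^ n = z ^ n"
      by (simp flip: power_mult_distrib)
    then show "((-w) gchoose n) * (-z) ^ n = pochhammer w n / fact n * z ^ n"
      by (simp add: gbinomial_pochhammer field_simps)
  qed
  finally show ?thesis by simp
qed

lemma not_nonpos_Int_if_Re_pos:
  fixes w :: complex
  assumes "Re w > 0"
  shows "w \<notin> \<int>\<^sub>\<le>\<^sub>0"
  using assms by (auto elim!: nonpos_Ints_cases)

lemma has_bochner_integral_Gamma_exp_complex_rate:
  assumes w: "Re w > 0" and p: "Re p > 0"
  shows "has_bochner_integral lborel (\<lambda>u. exp (w * of_real u - p * of_real (exp u)))
           (Gamma w * p powr (-w))"
proof -
  \<comment> \<open>Every \<open>p\<close> in the right half-plane lies in a disc of centre \<open>r\<close> and radius less than \<open>r\<close>,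
     so \<open>exp (q * exp u)\<close> with \<open>q = r - p\<close> can be expanded and integrated termwise.\<close>
  define r where "r = (norm p)\<^sup>2 / Re p"
  define q where "q = of_real r - p"
  have "p \<noteq> 0" using p by auto
  then have r: "r > 0" using p by (simp add: r_def)
  \<comment> \<open>The triangle with vertices 0, \<open>p\<close> and \<open>r\<close> has a right
    angle at \<open>p\<close>, so Pythagoras gives \<open>norm q < r\<close>.\<close>
  have "r * Re p = (norm p)\<^sup>2" using p by (simp add: r_def)
  then have "(norm q)\<^sup>2 = r\<^sup>2 - (norm p)\<^sup>2"
    by (simp add: q_def cmod_power2 power2_diff)
  also have "\<dots> < r\<^sup>2" using \<open>p \<noteq> 0\<close> by simp
  finally have q: "norm q < r"
    using r by (simp add: power2_less_imp_less)
  define f where "f n u = q ^ n / fact n *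
      exp ((w + of_nat n) * of_real u - of_real (r * exp u))" for n u
  have exp_power: "exp (complex_of_real u) ^ n = exp (of_nat n * of_real u)" for n u
    by (simp add: exp_of_nat_mult)
  have f_alt: "f n u = exp (w * of_real u - of_real (r * exp u)) * ((q * of_real (exp u)) ^ n / fact n)"
    for n u
    by (simp add: f_def exp_diff exp_add distrib_right power_mult_distrib exp_power
        exp_of_real[symmetric]) (simp add: mult_ac)
  have Gamma_shift: "Gamma (z + of_nat n) = pochhammer z n * Gamma z" if "Re z > 0" for z :: complex and n
    using pochhammer_Gamma[of z n] not_nonpos_Int_if_Re_pos[OF that] by (simp add: Gamma_eq_zero_iff)
  have powr_shift: "of_real r powr (-(z + of_nat n)) = of_real r powr (-z) / of_real r ^ n" for z :: complex and n
    using r by (simp add: powr_diff powr_nat')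
  have int_f: "has_bochner_integral lborel (f n)
      (Gamma w * of_real r powr (-w) * (pochhammer w n / fact n * (q / of_real r) ^ n))" for n
  proof -
    have "has_bochner_integral lborel (f n)
        (q ^ n / fact n * (Gamma (w + of_nat n) * of_real r powr (-(w + of_nat n))))"
      unfolding f_def using w r
      by (intro has_bochner_integral_mult_right has_bochner_integral_Gamma_exp_rate) auto
    then show ?thesis
      by (simp only: Gamma_shift[OF w] powr_shift) (simp add: power_divide mult_ac)
  qed
  have int_norm_f: "has_bochner_integral lborel (\<lambda>u. norm (f n u))
      (Gamma (Re w) * r powr (-Re w) * (pochhammer (Re w) n / fact n * (norm q / r) ^ n))" for n
  proof -
    have "has_bochner_integral lborel (\<lambda>u. norm q ^ n / fact n * exp ((Re w + n) * u - r * exp u))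
        (norm q ^ n / fact n * (Gamma (Re w + n) * r powr (-(Re w + n))))"
      using w r by (intro has_bochner_integral_mult_right has_bochner_integral_Gamma_exp_rate_real) auto
    moreover have "norm (f n u) = norm q ^ n / fact n * exp ((Re w + n) * u - r * exp u)" for u
      by (simp add: f_def norm_mult norm_divide norm_power)
    moreover have "Gamma (Re w + n) = pochhammer (Re w) n * Gamma (Re w)"
    proof -
      have "Re w \<notin> \<int>\<^sub>\<le>\<^sub>0"
        using w by (auto elim!: nonpos_Ints_cases)
      then show ?thesis
        using pochhammer_Gamma[of "Re w" n] Gamma_real_pos[OF w] by simp
    qed
    moreover have "r powr (-(Re w + n)) = r powr (- Re w) / r ^ n"
      using r by (simp add: powr_diff powr_realpow)
    ultimately show ?thesis
      by (simp add: power_divide mult_ac)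
  qed
  have sum_f: "(\<lambda>n. f n u) sums exp (w * of_real u - p * of_real (exp u))" for u
  proof -
    have "(\<lambda>n. exp (w * of_real u - of_real (r * exp u)) * ((q * of_real (exp u)) ^ n / fact n)) sums
        (exp (w * of_real u - of_real (r * exp u)) * exp (q * of_real (exp u)))"
      using exp_converges[of "q * of_real (exp u)"]
      by (intro sums_mult) (simp add: scaleR_conv_of_real field_simps)
    moreover have "exp (w * of_real u - of_real (r * exp u)) * exp (q * of_real (exp u)) =
        exp (w * of_real u - p * of_real (exp u))"
      by (simp add: mult_exp_exp q_def algebra_simps)
    ultimately show ?thesis by (simp add: f_alt)
  qed
  have summable_f: "summable (\<lambda>n. norm (f n u))" for u
  proof -
    have "summable (\<lambda>n. norm (exp (w * of_real u - of_real (r * exp u))) *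
        norm ((q * of_real (exp u)) ^ n /\<^sub>R fact n))"
      by (intro summable_mult summable_norm_exp)
    then show ?thesis
      by (simp add: f_alt norm_mult norm_divide field_simps)
  qed
  \<comment> \<open>Up to a constant factor, the integrals of the norms form the same binomial
    series at the real parameters \<open>Re w\<close> and \<open>norm q / r < 1\<close>; its
    convergence permits termwise integration.\<close>
  have "summable (\<lambda>n. pochhammer (complex_of_real (Re w)) n / fact n * of_real (norm q / r) ^ n)"
    using q r by (intro sums_summable[OF pochhammer_series_sums_powr]) (simp add: norm_divide)
  then have "summable (\<lambda>n. complex_of_real (pochhammer (Re w) n / fact n * (norm q / r) ^ n))"
    by (simp add: pochhammer_of_real)
  then have summable_int: "summable (\<lambda>n. \<integral>u. norm (f n u) \<partial>lborel)"
    unfolding has_bochner_integral_integral_eq[OF int_norm_f] summable_of_real_iff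
    by (rule summable_mult)
  have "integrable lborel (f n)" for n
    using int_f[of n] by (simp add: has_bochner_integral_iff)
  note int = integrable_suminf[OF this AE_I2[OF summable_f] summable_int]
    sums_integral[OF this AE_I2[OF summable_f] summable_int]
  have "(\<lambda>n. Gamma w * of_real r powr (-w) * (pochhammer w n / fact n * (q / of_real r) ^ n)) sums
      (Gamma w * of_real r powr (-w) * (1 - q / of_real r) powr (-w))"
    using q r by (intro sums_mult pochhammer_series_sums_powr) (simp add: norm_divide)
  \<comment> \<open>The power of the product needs no branch correction because the factor
    \<open>r\<close> is a positive real.\<close>
  moreover have "of_real r powr (-w) * (1 - q / of_real r) powr (-w) = p powr (-w)"
    using r by (subst powr_times_real_left[symmetric]) (auto simp: q_def field_simps)
  ultimately show ?thesis
    using int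
    by (simp add: has_bochner_integral_integral_eq[OF int_f] sums_unique[OF sum_f, symmetric]
        has_bochner_integral_iff mult.assoc sums_unique2)
qed

section \<open>Decay of Gamma on vertical lines and integrability\<close>

lemma norm_Gamma_le_exp:
  assumes c: "c > 0" and \<theta>: "0 \<le> \<theta>" "\<theta> < pi / 2"
  shows "norm (Gamma (Complex c v)) \<le> Gamma c * cos \<theta> powr (-c) * exp (-\<theta> * \<bar>v\<bar>)"
proof -
  \<comment> \<open>The sign of \<phi> follows that of \<open>v\<close>, so
    \<open>cis \<phi> powr (- w)\<close> has modulus \<open>exp (\<theta> * \<bar>v\<bar>)\<close>
    in both directions, while the norm of the integrand only sees the rate
    \<open>cos \<theta>\<close>.\<close>
  define \<phi> where "\<phi> = (if v \<ge> 0 then \<theta> else -\<theta>)"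
  have cos_\<phi>: "cos \<phi> = cos \<theta>" "cos \<theta> > 0"
    using \<theta> by (auto simp: \<phi>_def intro!: cos_gt_zero_pi)
  have \<phi>: "\<phi> \<in> {-pi<..pi}"
    using \<theta> by (auto simp: \<phi>_def)
  let ?w = "Complex c v"
  let ?f = "\<lambda>u. exp (?w * of_real u - cis \<phi> * of_real (exp u))"
  have int: "has_bochner_integral lborel ?f (Gamma ?w * cis \<phi> powr (-?w))"
    using c cos_\<phi> by (intro has_bochner_integral_Gamma_exp_complex_rate) auto
  have int': "has_bochner_integral lborel (\<lambda>u. exp (c * u - cos \<theta> * exp u)) (Gamma c * cos \<theta> powr (-c))"
    using c cos_\<phi> by (intro has_bochner_integral_Gamma_exp_rate_real) auto
  have "norm (Gamma ?w * cis \<phi> powr (-?w)) \<le> (\<integral>u. norm (?f u) \<partial>lborel)"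
    using integral_norm_bound[of lborel ?f] has_bochner_integral_integral_eq[OF int] by simp
  also have "(\<lambda>u. norm (?f u)) = (\<lambda>u. exp (c * u - cos \<theta> * exp u))"
    by (simp add: cos_\<phi>)
  also have "integral\<^sup>L lborel \<dots> = Gamma c * cos \<theta> powr (-c)"
    using int' by (rule has_bochner_integral_integral_eq)
  also have "norm (Gamma ?w * cis \<phi> powr (-?w)) = norm (Gamma ?w) * exp (\<theta> * \<bar>v\<bar>)"
    using \<phi> by (simp add: norm_mult norm_powr_complex Arg_cis) (simp add: \<phi>_def mult_ac)
  finally show ?thesis
    by (simp add: exp_minus field_simps)
qed

lemma has_bochner_integral_half_lines:
  fixes g :: "real \<Rightarrow> 'a :: {banach, second_countable_topology}"
  assumes [measurable]: "g \<in> borel_measurable borel"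
    and pos: "has_bochner_integral lborel (\<lambda>x. indicator {0<..} x *\<^sub>R g x) I"
    and neg: "has_bochner_integral lborel (\<lambda>x. indicator {0<..} x *\<^sub>R g (-x)) J"
  shows "has_bochner_integral lborel g (I + J)"
proof -
  have "has_bochner_integral lborel (\<lambda>x. indicator {0<..} (0 + (-1) * x) *\<^sub>R g (- (0 + (-1) * x))) (J /\<^sub>R \<bar>-1\<bar>)"
    using neg by (subst (asm) lborel_has_bochner_integral_real_affine_iff[of "-1" _ _ 0]) auto
  then have "has_bochner_integral lborel (\<lambda>x. indicator {0<..} (-x) *\<^sub>R g x) J"
    by simp
  with pos have "has_bochner_integral lborel
      (\<lambda>x. indicator {0<..} x *\<^sub>R g x + indicator {0<..} (-x) *\<^sub>R g x) (I + J)"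
    by (rule has_bochner_integral_add)
  moreover have "AE x in lborel. indicator {0<..} x *\<^sub>R g x + indicator {0<..} (-x) *\<^sub>R g x = g x"
    using AE_lborel_singleton[of "0::real"]
    by eventually_elim (auto simp: indicator_def)
  ultimately show ?thesis
    by (subst (asm) has_bochner_integral_cong_AE) auto
qed

text \<open>This is \<open>exp (- (x powr \<alpha>))\<close> on \<open>x > 0\<close> in the variable
  \<open>u = ln x\<close>; scaling \<open>u\<close> by \<alpha> reduces it to the Gamma integral at
  \<open>1 / \<alpha>\<close>.\<close>

lemma integrable_exp_minus_exp_mult:
  fixes \<alpha> :: real
  assumes "\<alpha> > 0"
  shows "integrable lborel (\<lambda>u. exp (u - exp (\<alpha> * u)))"
proof -
  have "integrable lborel (\<lambda>u. exp (1 / \<alpha> * u - 1 * exp u))"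
    using has_bochner_integral_Gamma_exp_rate_real[of "1 / \<alpha>" 1] assms
    by (auto simp: has_bochner_integral_iff)
  then have "integrable lborel (\<lambda>u. exp (1 / \<alpha> * (0 + \<alpha> * u) - 1 * exp (0 + \<alpha> * u)))"
    using assms by (intro lborel_integrable_real_affine) auto
  then show ?thesis using assms by simp
qed

lemma integrable_exp_minus_abs_powr:
  fixes \<alpha> :: real
  assumes "\<alpha> > 0"
  shows "integrable lborel (\<lambda>x. exp (- (\<bar>x\<bar> powr \<alpha>)))"
proof -
  let ?f = "\<lambda>x::real. exp (- (\<bar>x\<bar> powr \<alpha>))"
  have "has_bochner_integral lborel (\<lambda>u. exp u *\<^sub>R ?f (exp u)) (\<integral>u. exp (u - exp (\<alpha> * u)) \<partial>lborel)"
    using integrable_exp_minus_exp_mult[OF assms]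
    by (simp add: has_bochner_integral_iff mult_exp_exp powr_def mult.commute)
  then have "has_bochner_integral lborel (\<lambda>x. indicator {0<..} x *\<^sub>R ?f x)
      (\<integral>u. exp (u - exp (\<alpha> * u)) \<partial>lborel)"
    by (subst (asm) has_bochner_integral_exp_substitution) measurable
  then have "has_bochner_integral lborel ?f
      ((\<integral>u. exp (u - exp (\<alpha> * u)) \<partial>lborel) + (\<integral>u. exp (u - exp (\<alpha> * u)) \<partial>lborel))"
    by (intro has_bochner_integral_half_lines) auto
  then show ?thesis
    by (simp add: has_bochner_integral_iff)
qed

lemma integrable_exp_minus_mult_abs:
  fixes \<kappa> :: real
  assumes "\<kappa> > 0"
  shows "integrable lborel (\<lambda>v. exp (- \<kappa> * \<bar>v\<bar>))"
proof -
  have "integrable lborel (\<lambda>v. exp (- (\<bar>0 + \<kappa> * v\<bar> powr 1)))"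
    using assms by (intro lborel_integrable_real_affine integrable_exp_minus_abs_powr) auto
  then show ?thesis using assms by (simp add: abs_mult)
qed

lemma continuous_on_Gamma_vertical:
  fixes f :: "real \<Rightarrow> complex"
  assumes "continuous_on UNIV f" "\<And>y. Re (f y) > 0"
  shows "continuous_on UNIV (\<lambda>y. Gamma (f y))"
proof (rule continuous_on_compose2[OF _ assms(1)])
  show "continuous_on {z. Re z > 0} (Gamma :: complex \<Rightarrow> complex)"
    by (intro continuous_on_Gamma) (auto dest: not_nonpos_Int_if_Re_pos)
qed (use assms(2) in auto)

lemma continuous_on_Complex_const [continuous_intros]:
  "continuous_on A (Complex c)"
  by (simp add: Complex_eq continuous_intros)

lemma integrable_Gamma_vertical:
  assumes "c > 0"
  shows "integrable lborel (\<lambda>v. Gamma (Complex c v))"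
proof (rule Bochner_Integration.integrable_bound)
  \<comment> \<open>The angle 1 is an arbitrary choice strictly between 0 and
    \<open>pi / 2\<close>.\<close>
  show "integrable lborel (\<lambda>v. Gamma c * cos 1 powr (-c) * exp (-1 * \<bar>v\<bar>))"
    by (intro integrable_mult_right integrable_exp_minus_mult_abs) simp
  have "(\<lambda>v. Gamma (Complex c v)) \<in> borel_measurable borel"
    using assms by (intro borel_measurable_continuous_onI continuous_on_Gamma_vertical continuous_intros) auto
  then show "(\<lambda>v. Gamma (Complex c v)) \<in> borel_measurable lborel"
    by simp
  have "norm (Gamma (Complex c v)) \<le> norm (Gamma c * cos 1 powr (-c) * exp (-1 * \<bar>v\<bar>))" for v
    using norm_Gamma_le_exp[OF assms, of 1 v] pi_gt3 by simp
  then show "AE v in lborel. norm (Gamma (Complex c v)) \<le> norm (Gamma c * cos 1 powr (-c) * exp (-1 * \<bar>v\<bar>))"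
    by simp
qed

text \<open>Justifies Fubini in both exchanges of integrals below: each kernel differs from a
  product of integrable functions only by a factor of modulus one.\<close>

lemma integrable_pair_mult:
  fixes f g :: "real \<Rightarrow> complex" and h :: "real \<times> real \<Rightarrow> complex"
  assumes f: "integrable lborel f" and g: "integrable lborel g"
    and [measurable]: "h \<in> borel_measurable (borel \<Otimes>\<^sub>M borel)"
    and bound: "\<And>x y. norm (h (x, y)) \<le> norm (f x) * norm (g y)"
  shows "integrable (lborel \<Otimes>\<^sub>M lborel) h"
proof -
  have [measurable]: "f \<in> borel_measurable borel" "g \<in> borel_measurable borel"
    using f g by auto
  have "integrable (lborel \<Otimes>\<^sub>M lborel) (\<lambda>(x, y). f x * g y)"
    using f g by (intro lborel_pair.Fubini_integrable) (auto simp: norm_mult)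
  then show ?thesis
    by (rule Bochner_Integration.integrable_bound) (auto simp: norm_mult bound)
qed

section \<open>Fourier inversion by Gaussian damping\<close>

lemma integral_std_normal_density_iexp:
  "(\<integral>v. std_normal_density v *\<^sub>R iexp (t * v) \<partial>lborel) = of_real (exp (- (t\<^sup>2) / 2))"
proof -
  have "(\<integral>v. std_normal_density v *\<^sub>R iexp (t * v) \<partial>lborel) = char std_normal_distribution t"
    unfolding char_def by (subst integral_density) auto
  then show ?thesis
    by (simp add: char_std_normal_distribution)
qed

text \<open>Damping the inversion integral by a wide Gaussian turns it, by Fubini, into a Gaussian
  average of \<open>f\<close> around \<open>x\<close> at scale \<epsilon>. As \<epsilon> tends to 0,
  dominated convergence applies to both sides: with majorant a multiple of \<open>norm (F v)\<close>
  on one, and by boundedness and continuity of \<open>f\<close> on the other.\<close>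

theorem Fourier_inversion:
  fixes f :: "real \<Rightarrow> complex"
  defines "F \<equiv> \<lambda>v. \<integral>u. f u * iexp (v * u) \<partial>lborel"
  assumes f: "integrable lborel f" and cont: "continuous_on UNIV f"
    and bounded: "\<And>u. norm (f u) \<le> B"
    and F: "integrable lborel F"
  shows "(\<integral>v. F v * iexp (- (v * x)) \<partial>lborel) = 2 * of_real pi * f x"
proof -
  define \<epsilon> where "\<epsilon> n = inverse (real (Suc n))" for n
  have \<epsilon>: "\<epsilon> n > 0" for n by (simp add: \<epsilon>_def)
  have \<epsilon>_lim: "\<epsilon> \<longlonglongrightarrow> 0"
    unfolding \<epsilon>_def by (rule LIMSEQ_inverse_real_of_nat)
  have [measurable]: "f \<in> borel_measurable borel" "F \<in> borel_measurable borel"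
    using f F by auto
  let ?\<phi> = std_normal_density
  have \<phi>_cont: "continuous_on UNIV ?\<phi>"
    unfolding std_normal_density_def by (intro continuous_intros) auto
  have \<phi>_le: "\<bar>?\<phi> z\<bar> \<le> 1 / sqrt (2 * pi)" for z
    by (simp add: std_normal_density_def divide_right_mono)
  have \<phi>_int: "integrable lborel ?\<phi>"
    using integrable_std_normal_moment[of 0] by simp
  have \<phi>_scaled: "integrable lborel (\<lambda>v. of_real (?\<phi> (\<epsilon> n * v)) :: complex)" for n
    using lborel_integrable_real_affine[OF \<phi>_int, of "\<epsilon> n" 0] \<epsilon>[of n]
    by (simp add: complex_of_real_integrable_eq)
  have mollified: "(\<integral>v. ?\<phi> (\<epsilon> n * v) *\<^sub>R (F v * iexp (- (v * x))) \<partial>lborel) =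
      (\<integral>z. exp (- (z\<^sup>2) / 2) *\<^sub>R f (x + \<epsilon> n * z) \<partial>lborel)" for n
  proof -
    let ?h = "\<lambda>v u. of_real (?\<phi> (\<epsilon> n * v)) * f u * iexp (v * (u - x))"
    have int: "integrable (lborel \<Otimes>\<^sub>M lborel) (case_prod ?h)"
      by (rule integrable_pair_mult[OF \<phi>_scaled f]) (auto simp: norm_mult)
    have "?\<phi> (\<epsilon> n * v) *\<^sub>R (F v * iexp (- (v * x))) = (\<integral>u. ?h v u \<partial>lborel)" for v
    proof -
      have "(\<integral>u. ?h v u \<partial>lborel) =
          (\<integral>u. (of_real (?\<phi> (\<epsilon> n * v)) * iexp (- (v * x))) * (f u * iexp (v * u)) \<partial>lborel)"
        by (intro Bochner_Integration.integral_cong) (auto simp: algebra_simps mult_exp_exp)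
      also have "\<dots> = of_real (?\<phi> (\<epsilon> n * v)) * iexp (- (v * x)) * F v"
        unfolding F_def by (rule integral_mult_right_zero)
      finally show ?thesis
        by (simp add: scaleR_conv_of_real mult_ac)
    qed
    then have "(\<integral>v. ?\<phi> (\<epsilon> n * v) *\<^sub>R (F v * iexp (- (v * x))) \<partial>lborel) =
        (\<integral>v. (\<integral>u. ?h v u \<partial>lborel) \<partial>lborel)"
      by simp
    also have "\<dots> = (\<integral>u. (\<integral>v. ?h v u \<partial>lborel) \<partial>lborel)"
      by (rule lborel_pair.Fubini_integral[OF int, symmetric])
    \<comment> \<open>Substituting \<open>u = x + \<epsilon> n * z\<close> makes the averaging
      weight independent of \<open>n\<close>.\<close>
    also have "\<dots> = \<bar>\<epsilon> n\<bar> *\<^sub>R (\<integral>z. (\<integral>v. ?h v (x + \<epsilon> n * z) \<partial>lborel) \<partial>lborel)"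
      using \<epsilon>[of n] by (intro lborel_integral_real_affine) auto
    also have "\<dots> = (\<integral>z. \<epsilon> n *\<^sub>R (\<integral>v. ?h v (x + \<epsilon> n * z) \<partial>lborel) \<partial>lborel)"
      using \<epsilon>[of n] by simp
    also have "(\<lambda>z. \<epsilon> n *\<^sub>R (\<integral>v. ?h v (x + \<epsilon> n * z) \<partial>lborel)) = (\<lambda>z. exp (- (z\<^sup>2) / 2) *\<^sub>R f (x + \<epsilon> n * z))"
    proof
      fix z
      \<comment> \<open>The Gaussian transform, with its variable rescaled by \<epsilon>, absorbs
        the Jacobian of the substitution in \<open>u\<close>.\<close>
      have "of_real (exp (- (z\<^sup>2) / 2)) = (\<integral>v. ?\<phi> v *\<^sub>R iexp (z * v) \<partial>lborel)"
        by (rule integral_std_normal_density_iexp[symmetric])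
      also have "\<dots> = \<bar>\<epsilon> n\<bar> *\<^sub>R (\<integral>v. ?\<phi> (0 + \<epsilon> n * v) *\<^sub>R iexp (z * (0 + \<epsilon> n * v)) \<partial>lborel)"
        using \<epsilon>[of n] by (intro lborel_integral_real_affine) auto
      also have "\<dots> = \<epsilon> n *\<^sub>R (\<integral>v. of_real (?\<phi> (\<epsilon> n * v)) * iexp (v * (\<epsilon> n * z)) \<partial>lborel)"
        using \<epsilon>[of n] by (simp add: scaleR_conv_of_real mult_ac)
      finally have "exp (- (z\<^sup>2) / 2) *\<^sub>R f (x + \<epsilon> n * z) =
          \<epsilon> n *\<^sub>R ((\<integral>v. of_real (?\<phi> (\<epsilon> n * v)) * iexp (v * (\<epsilon> n * z)) \<partial>lborel) * f (x + \<epsilon> n * z))"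
        by (simp add: scaleR_conv_of_real)
      also have "\<dots> = \<epsilon> n *\<^sub>R (\<integral>v. ?h v (x + \<epsilon> n * z) \<partial>lborel)"
        by (simp add: mult_ac flip: integral_mult_left_zero)
      finally show "\<epsilon> n *\<^sub>R (\<integral>v. ?h v (x + \<epsilon> n * z) \<partial>lborel) = exp (- (z\<^sup>2) / 2) *\<^sub>R f (x + \<epsilon> n * z)" ..
    qed
    finally show ?thesis .
  qed
  have "(\<lambda>n. \<integral>v. ?\<phi> (\<epsilon> n * v) *\<^sub>R (F v * iexp (- (v * x))) \<partial>lborel) \<longlonglongrightarrow>
      (\<integral>v. ?\<phi> 0 *\<^sub>R (F v * iexp (- (v * x))) \<partial>lborel)"
  proof (rule integral_dominated_convergence)
    show "integrable lborel (\<lambda>v. 1 / sqrt (2 * pi) * norm (F v))"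
      using F by (intro integrable_mult_right integrable_norm)
    have "(\<lambda>n. ?\<phi> (\<epsilon> n * v)) \<longlonglongrightarrow> ?\<phi> (0 * v)" for v
      using \<phi>_cont by (intro continuous_on_tendsto_compose[of UNIV ?\<phi>] tendsto_intros \<epsilon>_lim) auto
    then show "AE v in lborel. (\<lambda>n. ?\<phi> (\<epsilon> n * v) *\<^sub>R (F v * iexp (- (v * x)))) \<longlonglongrightarrow>
        ?\<phi> 0 *\<^sub>R (F v * iexp (- (v * x)))"
      by (auto intro!: tendsto_intros)
    show "AE v in lborel. norm (?\<phi> (\<epsilon> n * v) *\<^sub>R (F v * iexp (- (v * x)))) \<le> 1 / sqrt (2 * pi) * norm (F v)" for n
      using mult_right_mono[OF \<phi>_le] by (auto simp: norm_mult)
  qed auto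
  moreover have "(\<lambda>n. \<integral>z. exp (- (z\<^sup>2) / 2) *\<^sub>R f (x + \<epsilon> n * z) \<partial>lborel) \<longlonglongrightarrow>
      (\<integral>z. exp (- (z\<^sup>2) / 2) *\<^sub>R f x \<partial>lborel)"
  proof (rule integral_dominated_convergence)
    show "integrable lborel (\<lambda>z. sqrt (2 * pi) * ?\<phi> z * B)"
      using \<phi>_int by (intro integrable_mult_right integrable_mult_left)
    have "(\<lambda>n. f (x + \<epsilon> n * z)) \<longlonglongrightarrow> f (x + 0 * z)" for z
      using cont by (intro continuous_on_tendsto_compose[of UNIV f] tendsto_intros \<epsilon>_lim) auto
    then show "AE z in lborel. (\<lambda>n. exp (- (z\<^sup>2) / 2) *\<^sub>R f (x + \<epsilon> n * z)) \<longlonglongrightarrow> exp (- (z\<^sup>2) / 2) *\<^sub>R f x"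
      by (auto intro!: tendsto_intros)
    show "AE z in lborel. norm (exp (- (z\<^sup>2) / 2) *\<^sub>R f (x + \<epsilon> n * z)) \<le> sqrt (2 * pi) * ?\<phi> z * B" for n
      using bounded by (auto simp: std_normal_density_def mult_left_mono)
  qed auto
  ultimately have "(\<integral>v. ?\<phi> 0 *\<^sub>R (F v * iexp (- (v * x))) \<partial>lborel) = (\<integral>z. exp (- (z\<^sup>2) / 2) *\<^sub>R f x \<partial>lborel)"
    unfolding mollified by (rule LIMSEQ_unique)
  moreover have "(\<integral>z. exp (- (z\<^sup>2) / 2) *\<^sub>R f x \<partial>lborel) = sqrt (2 * pi) *\<^sub>R f x"
  proof -
    have "integrable lborel (\<lambda>z. sqrt (2 * pi) * ?\<phi> z)"
      using \<phi>_int by (rule integrable_mult_right)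
    then have int: "integrable lborel (\<lambda>z::real. exp (- (z\<^sup>2) / 2))"
      by (simp add: std_normal_density_def)
    have "(\<integral>z. exp (- (z\<^sup>2) / 2) \<partial>lborel) = (\<integral>z. sqrt (2 * pi) * ?\<phi> z \<partial>lborel)"
      by (simp add: std_normal_density_def)
    also have "\<dots> = sqrt (2 * pi)"
      using integral_std_normal_moment_even[of 0] by simp
    finally show ?thesis
      using int by (subst integral_scaleR_left) auto
  qed
  \<comment> \<open>The factor 2 pi arises as the total mass \<open>sqrt (2 * pi)\<close> of the
    weight divided by the density value \<open>1 / sqrt (2 * pi)\<close> at 0.\<close>
  ultimately have "(1 / sqrt (2 * pi)) *\<^sub>R (\<integral>v. F v * iexp (- (v * x)) \<partial>lborel) = sqrt (2 * pi) *\<^sub>R f x"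
    by (simp add: std_normal_density_def)
  then have "sqrt (2 * pi) *\<^sub>R (1 / sqrt (2 * pi)) *\<^sub>R (\<integral>v. F v * iexp (- (v * x)) \<partial>lborel) =
      sqrt (2 * pi) *\<^sub>R sqrt (2 * pi) *\<^sub>R f x"
    by simp
  then have "(\<integral>v. F v * iexp (- (v * x)) \<partial>lborel) = (2 * pi) *\<^sub>R f x"
    unfolding scaleR_scaleR by simp
  then show ?thesis
    by (simp add: scaleR_conv_of_real)
qed

section \<open>Mellin inversion and the Laplace-type integral\<close>

lemma integral_Gamma_vertical_exp:
  assumes "c > 0"
  shows "(\<integral>v. Gamma (Complex c v) * exp (- (Complex c v * of_real x)) \<partial>lborel) =
           2 * of_real pi * exp (- of_real (exp x))"
proof -
  define f where "f u = complex_of_real (exp (c * u - exp u))" for u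
  have f: "integrable lborel f"
    using has_bochner_integral_Gamma_exp_rate_real[of c 1] assms
    by (auto simp: f_def[abs_def] has_bochner_integral_iff complex_of_real_integrable_eq)
  have "f u * iexp (v * u) = exp (Complex c v * of_real u - of_real (exp u))" for u v
    by (simp add: f_def exp_of_real[symmetric] mult_exp_exp Complex_eq algebra_simps)
  then have F: "(\<integral>u. f u * iexp (v * u) \<partial>lborel) = Gamma (Complex c v)" for v
    using has_bochner_integral_Gamma_exp[of "Complex c v"] assms
    by (simp add: has_bochner_integral_iff)
  have bounded: "norm (f u) \<le> exp (c * ln c - c)" for u
  proof -
    \<comment> \<open>The exponent \<open>c * u - exp u\<close> is largest at
      \<open>u = ln c\<close>; the tangent bound for \<open>exp\<close> at that point gives the
      maximum.\<close>
    have "c * (1 + (u - ln c)) \<le> c * exp (u - ln c)"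
      using assms by (intro mult_left_mono exp_ge_add_one_self) auto
    also have "\<dots> = exp u"
      using assms by (simp add: exp_diff)
    finally show ?thesis
      by (simp add: f_def algebra_simps)
  qed
  have "(\<integral>v. (\<integral>u. f u * iexp (v * u) \<partial>lborel) * iexp (- (v * x)) \<partial>lborel) = 2 * of_real pi * f x"
  proof (rule Fourier_inversion[OF f _ bounded])
    show "continuous_on UNIV f"
      unfolding f_def by (intro continuous_intros)
    show "integrable lborel (\<lambda>v. \<integral>u. f u * iexp (v * u) \<partial>lborel)"
      unfolding F by (rule integrable_Gamma_vertical[OF assms])
  qed
  \<comment> \<open>Multiplying by \<open>exp (- c * x)\<close> completes the purely imaginary
    exponent to \<open>- Complex c v * x\<close> and removes the same weight from
    \<open>f x\<close>.\<close>
  then have "(\<integral>v. Gamma (Complex c v) * iexp (- (v * x)) \<partial>lborel) * exp (- of_real (c * x)) =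
      2 * of_real pi * f x * exp (- of_real (c * x))"
    unfolding F by (rule arg_cong)
  also have "\<dots> = 2 * of_real pi * exp (- of_real (exp x))"
    by (simp add: f_def exp_of_real[symmetric] mult_exp_exp)
  finally have "(\<integral>v. Gamma (Complex c v) * iexp (- (v * x)) * exp (- of_real (c * x)) \<partial>lborel) =
      2 * of_real pi * exp (- of_real (exp x))"
    by (simp only: integral_mult_left_zero)
  moreover have "Gamma (Complex c v) * iexp (- (v * x)) * exp (- of_real (c * x)) =
      Gamma (Complex c v) * exp (- (Complex c v * of_real x))" for v
    by (simp add: Complex_eq mult_exp_exp algebra_simps)
  ultimately show ?thesis by (simp only:)
qed

lemma integral_exp_minus_exp_mult_Laplace:
  assumes \<alpha>: "\<alpha> > 0" and c: "0 < c" "c < 1 / 2" and p: "Re p > 0"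
  shows "(\<integral>u. exp (of_real (u - exp (\<alpha> * u)) - p * of_real (exp u)) \<partial>lborel) =
    of_real (1 / (pi * \<alpha>)) *
    (\<integral>y. Gamma ((1 - 2 * Complex c y) / of_real \<alpha>) * Gamma (2 * Complex c y) *
         p powr (- (2 * Complex c y)) \<partial>lborel)"
proof -
  \<comment> \<open>The line \<open>Re w = d\<close> is the image of \<open>Re s = c\<close> under
    \<open>w = (1 - 2 * s) / \<alpha>\<close>. Mellin inversion needs \<open>d > 0\<close>, that is
    \<open>c < 1 / 2\<close>; the inner integral has parameter
    \<open>1 - \<alpha> * w = 2 * s\<close> and needs \<open>c > 0\<close>.\<close>
  define d where "d = (1 - 2 * c) / \<alpha>"
  have d: "d > 0" "\<alpha> * d = 1 - 2 * c" using \<alpha> c by (auto simp: d_def)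
  have affine: "Complex d (0 + - (2 / \<alpha>) * y) = (1 - 2 * Complex c y) / of_real \<alpha>" for y
    using \<alpha> by (simp add: complex_eq_iff d_def)
  let ?h = "\<lambda>u v. Gamma (Complex d v) * exp ((1 - of_real \<alpha> * Complex d v) * of_real u - p * of_real (exp u))"
  have Gamma_int: "integrable lborel (\<lambda>v. Gamma (Complex d v))"
    using d by (intro integrable_Gamma_vertical)
  then have [measurable]: "(\<lambda>v. Gamma (Complex d v)) \<in> borel_measurable borel" by auto
  have exp_int: "integrable lborel (\<lambda>u. exp (2 * of_real c * of_real u - p * of_real (exp u)))"
    using has_bochner_integral_Gamma_exp_complex_rate[of "2 * of_real c" p] c p
    by (simp add: has_bochner_integral_iff)
  have [measurable]: "Complex d \<in> borel_measurable borel"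
    by (intro borel_measurable_continuous_onI continuous_intros)
  have int: "integrable (lborel \<Otimes>\<^sub>M lborel) (case_prod ?h)"
    by (rule integrable_pair_mult[OF exp_int Gamma_int]) (auto simp: norm_mult d)
  have "(\<integral>v. ?h u v \<partial>lborel) = 2 * of_real pi * exp (of_real (u - exp (\<alpha> * u)) - p * of_real (exp u))" for u
  proof -
    have "(\<integral>v. ?h u v \<partial>lborel) = (\<integral>v. exp (of_real u - p * of_real (exp u)) *
        (Gamma (Complex d v) * exp (- (Complex d v * of_real (\<alpha> * u)))) \<partial>lborel)"
      by (intro Bochner_Integration.integral_cong) (auto simp: algebra_simps mult_exp_exp)
    also have "\<dots> = exp (of_real u - p * of_real (exp u)) * (2 * of_real pi * exp (- of_real (exp (\<alpha> * u))))"
      using d by (simp add: integral_Gamma_vertical_exp del: of_real_mult)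
    finally show ?thesis by (simp add: mult_exp_exp algebra_simps)
  qed
  then have "2 * of_real pi * (\<integral>u. exp (of_real (u - exp (\<alpha> * u)) - p * of_real (exp u)) \<partial>lborel) =
      (\<integral>u. (\<integral>v. ?h u v \<partial>lborel) \<partial>lborel)"
    by simp
  also have "\<dots> = (\<integral>v. (\<integral>u. ?h u v \<partial>lborel) \<partial>lborel)"
    by (rule lborel_pair.Fubini_integral[OF int, symmetric])
  also have "\<dots> = (\<integral>v. Gamma (Complex d v) * (Gamma (1 - of_real \<alpha> * Complex d v) *
      p powr (- (1 - of_real \<alpha> * Complex d v))) \<partial>lborel)"
  proof (intro Bochner_Integration.integral_cong refl)
    fix v
    have "Re (1 - of_real \<alpha> * Complex d v) > 0" using c d by simp
    from has_bochner_integral_Gamma_exp_complex_rate[OF this p]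
    show "(\<integral>u. ?h u v \<partial>lborel) = Gamma (Complex d v) * (Gamma (1 - of_real \<alpha> * Complex d v) *
      p powr (- (1 - of_real \<alpha> * Complex d v)))"
      by (simp add: has_bochner_integral_iff)
  qed
  \<comment> \<open>The passage from \<open>w\<close> to \<open>s\<close> is
    \<open>v = - (2 / \<alpha>) * y\<close>; its Jacobian and the factor 2 pi combine to
    \<open>1 / (pi * \<alpha>)\<close>.\<close>
  also have "\<dots> = \<bar>- (2 / \<alpha>)\<bar> *\<^sub>R (\<integral>y. Gamma (Complex d (0 + - (2 / \<alpha>) * y)) *
      (Gamma (1 - of_real \<alpha> * Complex d (0 + - (2 / \<alpha>) * y)) *
      p powr (- (1 - of_real \<alpha> * Complex d (0 + - (2 / \<alpha>) * y)))) \<partial>lborel)"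
    using lborel_integral_real_affine[of "- (2 / \<alpha>)" "\<lambda>v. Gamma (Complex d v) *
      (Gamma (1 - of_real \<alpha> * Complex d v) * p powr (- (1 - of_real \<alpha> * Complex d v)))" 0] \<alpha> by simp
  finally show ?thesis
    unfolding affine using \<alpha> by (simp add: scaleR_conv_of_real field_simps)
qed

section \<open>Passage to the imaginary axis\<close>

text \<open>In the closed right half-plane the argument is at most \<open>pi / 2\<close> in modulus.
  The bound is uniform in \<open>p\<close>, as domination along a sequence approaching the axis
  requires.\<close>

lemma norm_powr_le_half_plane:
  assumes "Re p \<ge> 0" "norm p \<ge> \<tau>" "\<tau> > 0" "a \<ge> 0"
  shows "norm (p powr (- Complex a b)) \<le> \<tau> powr (-a) * exp (pi / 2 * \<bar>b\<bar>)"
proof -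
  have "p \<noteq> 0" using assms by auto
  then have "\<bar>Arg p\<bar> \<le> pi / 2"
    using assms(1) Re_Ln_pos_le[of p] by (simp add: Arg_eq_Im_Ln)
  then have "b * Arg p \<le> pi / 2 * \<bar>b\<bar>"
    by (metis abs_ge_self abs_ge_zero abs_mult mult.commute mult_right_mono order_trans)
  moreover have "norm p powr (-a) \<le> \<tau> powr (-a)"
    using assms by (intro powr_mono2') auto
  ultimately show ?thesis
    by (auto simp: norm_powr_complex intro!: mult_mono)
qed

lemma norm_Gamma_Gamma_powr_bound:
  assumes \<alpha>: "\<alpha> > 0" and c: "0 < c" "c < 1 / 2" and \<tau>: "\<tau> > 0"
  obtains w where "integrable lborel w"
    "\<And>p y. Re p \<ge> 0 \<Longrightarrow> norm p \<ge> \<tau> \<Longrightarrow>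
       norm (Gamma ((1 - 2 * Complex c y) / of_real \<alpha>) * Gamma (2 * Complex c y) *
         p powr (- (2 * Complex c y))) \<le> w y"
proof -
  \<comment> \<open>The factor \<open>p powr (- 2 s)\<close> cancels at most the full exponential decay \<open>exp (- pi * \<bar>y\<bar>)\<close> of
     \<open>Gamma (2 s)\<close>; giving up \<open>\<eta>\<close> of the latter leaves the decay of the other Gamma factor to win.\<close>
  define \<eta> where "\<eta> = min 1 (1 / (2 * \<alpha>))"
  have \<eta>: "0 < \<eta>" "\<eta> \<le> 1" "\<eta> < 1 / \<alpha>" using \<alpha> by (auto simp: \<eta>_def min_def field_simps)
  define d where "d = (1 - 2 * c) / \<alpha>"
  have d: "d > 0" using \<alpha> c by (auto simp: d_def)
  define K where "K = (Gamma d * cos 1 powr (-d)) * (Gamma (2 * c) * cos (pi / 2 - \<eta>) powr (-(2 * c))) *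
    \<tau> powr (-(2 * c))"
  \<comment> \<open>Heights \<open>- (2 / \<alpha>) * y\<close> at angle 1 and \<open>2 * y\<close>
    at angle \<open>pi / 2 - \<eta>\<close> give this net rate once the growth
    \<open>exp (pi * \<bar>y\<bar>)\<close> of the power is cancelled.\<close>
  define \<kappa> where "\<kappa> = 2 / \<alpha> - 2 * \<eta>"
  have \<kappa>: "\<kappa> > 0" using \<eta> by (simp add: \<kappa>_def)
  show ?thesis
  proof
    show "integrable lborel (\<lambda>y. K * exp (- \<kappa> * \<bar>y\<bar>))"
      using \<kappa> by (intro integrable_mult_right integrable_exp_minus_mult_abs)
    fix p :: complex and y :: real assume p: "Re p \<ge> 0" "norm p \<ge> \<tau>"
    have eqs: "(1 - 2 * Complex c y) / of_real \<alpha> = Complex d (- (2 / \<alpha>) * y)"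
      "2 * Complex c y = Complex (2 * c) (2 * y)"
      using \<alpha> by (auto simp: complex_eq_iff d_def)
    have "norm (Gamma (Complex d (- (2 / \<alpha>) * y)) * Gamma (Complex (2 * c) (2 * y)) *
         p powr (- Complex (2 * c) (2 * y))) \<le>
      (Gamma d * cos 1 powr (-d) * exp (-1 * \<bar>- (2 / \<alpha>) * y\<bar>)) *
      (Gamma (2 * c) * cos (pi / 2 - \<eta>) powr (-(2 * c)) * exp (- (pi / 2 - \<eta>) * \<bar>2 * y\<bar>)) *
      (\<tau> powr (-(2 * c)) * exp (pi / 2 * \<bar>2 * y\<bar>))"
      unfolding norm_mult using d c \<eta> p \<tau> pi_gt3
      by (intro mult_mono norm_Gamma_le_exp norm_powr_le_half_plane mult_nonneg_nonneg) auto
    also have "\<dots> = K * (exp (-1 * \<bar>- (2 / \<alpha>) * y\<bar>) * exp (- (pi / 2 - \<eta>) * \<bar>2 * y\<bar>) * exp (pi / 2 * \<bar>2 * y\<bar>))"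
      by (simp add: K_def)
    also have "exp (-1 * \<bar>- (2 / \<alpha>) * y\<bar>) * exp (- (pi / 2 - \<eta>) * \<bar>2 * y\<bar>) * exp (pi / 2 * \<bar>2 * y\<bar>) =
        exp (- \<kappa> * \<bar>y\<bar>)"
      using \<alpha> by (simp add: mult_exp_exp \<kappa>_def abs_mult algebra_simps)
    finally show "norm (Gamma ((1 - 2 * Complex c y) / of_real \<alpha>) * Gamma (2 * Complex c y) *
         p powr (- (2 * Complex c y))) \<le> K * exp (- \<kappa> * \<bar>y\<bar>)"
      unfolding eqs(1) unfolding eqs(2) .
  qed
qed

lemma integral_exp_minus_exp_mult_Fourier:
  assumes \<alpha>: "\<alpha> > 0" and c: "0 < c" "c < 1 / 2" and \<tau>: "\<tau> \<noteq> 0"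
  shows "(\<integral>u. exp (of_real (u - exp (\<alpha> * u)) - \<i> * of_real \<tau> * of_real (exp u)) \<partial>lborel) =
    of_real (1 / (pi * \<alpha>)) *
    (\<integral>y. Gamma ((1 - 2 * Complex c y) / of_real \<alpha>) * Gamma (2 * Complex c y) *
         (\<i> * of_real \<tau>) powr (- (2 * Complex c y)) \<partial>lborel)" (is "?L = _ * ?R")
proof -
  \<comment> \<open>The points approach the axis horizontally, so their norm stays at least
    \<open>\<bar>\<tau>\<bar>\<close> and one majorant \<open>w\<close> serves them all.\<close>
  define p where "p n = of_real (inverse (real (Suc n))) + \<i> * of_real \<tau>" for n
  have "p \<longlonglongrightarrow> of_real 0 + \<i> * of_real \<tau>"
    unfolding p_def by (intro tendsto_intros LIMSEQ_inverse_real_of_nat)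
  then have p_lim: "p \<longlonglongrightarrow> \<i> * of_real \<tau>" by simp
  have p: "Re (p n) > 0" "norm (p n) \<ge> \<bar>\<tau>\<bar>" for n
    using abs_Im_le_cmod[of "p n"] by (auto simp: p_def)
  have Gamma_meas [measurable]: "(\<lambda>y. Gamma ((1 - 2 * Complex c y) / of_real \<alpha>)) \<in> borel_measurable borel"
    "(\<lambda>y. Gamma (2 * Complex c y)) \<in> borel_measurable borel"
    using \<alpha> c by (auto intro!: borel_measurable_continuous_onI continuous_on_Gamma_vertical continuous_intros)
  have powr_meas [measurable]: "(\<lambda>y. q powr (- (2 * Complex c y))) \<in> borel_measurable borel"
    if "q \<noteq> 0" for q
    using that by (auto simp: powr_def intro!: borel_measurable_continuous_onI continuous_intros)
  have [simp]: "p n \<noteq> 0" for n using p(1)[of n] by auto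
  obtain w where w: "integrable lborel w"
    "\<And>p y. Re p \<ge> 0 \<Longrightarrow> norm p \<ge> \<bar>\<tau>\<bar> \<Longrightarrow>
       norm (Gamma ((1 - 2 * Complex c y) / of_real \<alpha>) * Gamma (2 * Complex c y) *
         p powr (- (2 * Complex c y))) \<le> w y"
    using norm_Gamma_Gamma_powr_bound[OF \<alpha> c, of "\<bar>\<tau>\<bar>"] \<tau> by auto
  have "(\<lambda>n. \<integral>u. exp (of_real (u - exp (\<alpha> * u)) - p n * of_real (exp u)) \<partial>lborel) \<longlonglongrightarrow> ?L"
  proof (rule integral_dominated_convergence)
    show "integrable lborel (\<lambda>u. exp (u - exp (\<alpha> * u)))"
      by (rule integrable_exp_minus_exp_mult[OF \<alpha>])
    show "AE u in lborel. (\<lambda>n. exp (of_real (u - exp (\<alpha> * u)) - p n * of_real (exp u))) \<longlonglongrightarrow>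
        exp (of_real (u - exp (\<alpha> * u)) - \<i> * of_real \<tau> * of_real (exp u))"
      by (intro AE_I2 tendsto_intros p_lim)
    show "AE u in lborel. norm (exp (of_real (u - exp (\<alpha> * u)) - p n * of_real (exp u))) \<le> exp (u - exp (\<alpha> * u))" for n
      using p(1)[of n] by (intro AE_I2) simp
  qed auto
  moreover have "(\<lambda>n. \<integral>y. Gamma ((1 - 2 * Complex c y) / of_real \<alpha>) * Gamma (2 * Complex c y) *
         p n powr (- (2 * Complex c y)) \<partial>lborel) \<longlonglongrightarrow> ?R"
  proof (rule integral_dominated_convergence[OF _ _ w(1)])
    \<comment> \<open>The limit point avoids the branch cut, so the power is continuous
      there.\<close>
    have "\<i> * of_real \<tau> \<notin> \<real>\<^sub>\<le>\<^sub>0" using \<tau> by (auto simp: complex_nonpos_Reals_iff)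
    then show "AE y in lborel. (\<lambda>n. Gamma ((1 - 2 * Complex c y) / of_real \<alpha>) * Gamma (2 * Complex c y) *
         p n powr (- (2 * Complex c y))) \<longlonglongrightarrow> Gamma ((1 - 2 * Complex c y) / of_real \<alpha>) * Gamma (2 * Complex c y) *
         (\<i> * of_real \<tau>) powr (- (2 * Complex c y))"
      by (intro AE_I2 tendsto_intros p_lim tendsto_powr_complex)
    show "AE y in lborel. norm (Gamma ((1 - 2 * Complex c y) / of_real \<alpha>) * Gamma (2 * Complex c y) *
         p n powr (- (2 * Complex c y))) \<le> w y" for n
      using p[of n] by (intro AE_I2 w) auto
  qed (use \<tau> in auto)
  then have "(\<lambda>n. \<integral>u. exp (of_real (u - exp (\<alpha> * u)) - p n * of_real (exp u)) \<partial>lborel) \<longlonglongrightarrow>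
      of_real (1 / (pi * \<alpha>)) * ?R"
    unfolding integral_exp_minus_exp_mult_Laplace[OF \<alpha> c p(1)] by (intro tendsto_intros)
  ultimately show ?thesis by (rule LIMSEQ_unique)
qed

section \<open>Gamma identities and the kernel of the H-function\<close>

text \<open>Expanding the fraction by \<open>Gamma (s + 1 / 2)\<close> turns the numerator into a
  case of duplication and the denominator into a case of reflection.\<close>

lemma Gamma_ratio_eq_cos:
  fixes s :: complex
  assumes "0 < Re s" "Re s < 1 / 2"
  shows "Gamma s / Gamma (1 / 2 - s) =
    exp ((1 - 2 * s) * of_real (ln 2)) * Gamma (2 * s) * cos (of_real pi * s) / of_real (sqrt pi)"
proof -
  have nonpos: "s \<notin> \<int>\<^sub>\<le>\<^sub>0" "s + 1 / 2 \<notin> \<int>\<^sub>\<le>\<^sub>0" "1 / 2 - s \<notin> \<int>\<^sub>\<le>\<^sub>0"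
    using assms by (auto intro!: not_nonpos_Int_if_Re_pos)
  then have nz: "Gamma (s + 1 / 2) \<noteq> 0" "Gamma (1 / 2 - s) \<noteq> 0"
    by (auto simp: Gamma_eq_zero_iff)
  have "sin (of_real pi * (s + 1 / 2)) = cos (of_real pi * s)"
  proof -
    have "of_real pi * (s + 1 / 2) = of_real pi * s + of_real (pi / 2)"
      by (simp add: algebra_simps)
    then show ?thesis
      by (simp only: sin_add sin_of_real cos_of_real sin_pi_half cos_pi_half) simp
  qed
  then have refl: "Gamma (s + 1 / 2) * Gamma (1 / 2 - s) = of_real pi / cos (of_real pi * s)"
    using Gamma_reflection_complex[of "s + 1 / 2"] by (simp add: algebra_simps)
  \<comment> \<open>A zero cosine would make the right side of \<open>refl\<close> zero, as division
    by zero yields 0, but the left side is a product of nonzero values.\<close>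
  with nz have "cos (of_real pi * s) \<noteq> 0" by auto
  have "Gamma s / Gamma (1 / 2 - s) = (Gamma s * Gamma (s + 1 / 2)) / (Gamma (s + 1 / 2) * Gamma (1 / 2 - s))"
    using nz by simp
  also have "\<dots> = exp ((1 - 2 * s) * of_real (ln 2)) * of_real (sqrt pi) * Gamma (2 * s) *
      cos (of_real pi * s) / of_real pi"
    unfolding refl Gamma_legendre_duplication[OF nonpos(1,2)] by simp
  also have "\<dots> = exp ((1 - 2 * s) * of_real (ln 2)) * Gamma (2 * s) * cos (of_real pi * s) *
      of_real (sqrt pi / pi)"
    by simp
  also have "sqrt pi / pi = 1 / sqrt pi"
    by (simp add: field_simps)
  finally show ?thesis by simp
qed

text \<open>The two logarithms have imaginary parts \<open>pi / 2\<close> and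
  \<open>- pi / 2\<close>, so the sum is Euler's formula for the cosine. Changing the sign of \<tau>
  merely swaps the summands.\<close>

lemma powr_ii_plus_powr_minus_ii:
  fixes \<tau> :: real and s :: complex
  assumes "\<tau> \<noteq> 0"
  shows "(\<i> * of_real \<tau>) powr (- (2 * s)) + (\<i> * of_real (-\<tau>)) powr (- (2 * s)) =
    2 * cos (of_real pi * s) * exp (- (2 * s) * of_real (ln \<bar>\<tau>\<bar>))"
proof -
  have pos: "(\<i> * of_real \<tau>) powr (- (2 * s)) + (\<i> * of_real (-\<tau>)) powr (- (2 * s)) =
    2 * cos (of_real pi * s) * exp (- (2 * s) * of_real (ln \<tau>))" if "\<tau> > 0" for \<tau>
  proof -
    have "Ln (\<i> * of_real \<tau>) = of_real (ln \<tau>) + \<i> * of_real pi / 2"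
      "Ln (\<i> * of_real (-\<tau>)) = of_real (ln \<tau>) - \<i> * of_real pi / 2"
      using that Ln_times_of_real[of \<tau> \<i>] Ln_times_of_real[of \<tau> "-\<i>"]
      by (simp_all add: mult.commute Ln_of_real)
    then have "(\<i> * of_real \<tau>) powr (- (2 * s)) + (\<i> * of_real (-\<tau>)) powr (- (2 * s)) =
      exp (- (2 * s) * of_real (ln \<tau>)) * (exp (- (\<i> * (of_real pi * s))) + exp (\<i> * (of_real pi * s)))"
      using that by (simp add: powr_def ring_distribs mult_exp_exp) (simp add: algebra_simps)
    then show ?thesis
      by (simp add: cos_exp_eq mult_ac add.commute)
  qed
  show ?thesis
    using pos[of \<tau>] pos[of "-\<tau>"] assms by (cases "\<tau> > 0") (auto simp: add.commute)
qed

lemma fox_H_kernel_eq: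
  "fox_H_kernel 1 1 [(1 - 1 / \<alpha>, 2 / \<alpha>)] [(0, 1), (1/2, 1)] s =
    Gamma s / Gamma (1 / 2 - s) * Gamma ((1 - 2 * s) / of_real \<alpha>)"
proof -
  have "{1..<2} = {1::nat}" by auto
  then show ?thesis
    by (simp add: fox_H_kernel_def numeral_2_eq_2 diff_divide_distrib)
qed

section \<open>The characteristic function\<close>

lemma integral_exp_minus_abs_powr_iexp:
  assumes \<alpha>: "\<alpha> > 0" and c: "0 < c" "c < 1 / 2" and \<tau>: "\<tau> \<noteq> 0"
  shows "(\<integral>x. exp (- (\<bar>x\<bar> powr \<alpha>)) *\<^sub>R iexp (\<tau> * x) \<partial>lborel) =
    of_real (2 * sqrt pi / \<alpha>) * fox_H 1 1 [(1 - 1 / \<alpha>, 2 / \<alpha>)] [(0, 1), (1/2, 1)] c (\<tau>\<^sup>2 / 4)"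
proof -
  \<comment> \<open>\<open>I \<tau>\<close> is the integral of
    \<open>exp (- (x powr \<alpha>) - \<i> * \<tau> * x)\<close> over \<open>x > 0\<close>; hence
    frequency \<tau> contributes \<open>I (-\<tau>)\<close> from the positive half-line and
    \<open>I \<tau>\<close> from the negative one.\<close>
  define I where "I \<tau> = (\<integral>u. exp (of_real (u - exp (\<alpha> * u)) - \<i> * of_real \<tau> * of_real (exp u)) \<partial>lborel)" for \<tau>
  define G where "G \<tau> y = Gamma ((1 - 2 * Complex c y) / of_real \<alpha>) * Gamma (2 * Complex c y) *
         (\<i> * of_real \<tau>) powr (- (2 * Complex c y))" for \<tau> y
  let ?g = "\<lambda>x. exp (- (\<bar>x\<bar> powr \<alpha>)) *\<^sub>R iexp (\<tau> * x)"
  have half: "has_bochner_integral lborel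
      (\<lambda>x. indicator {0<..} x *\<^sub>R (exp (- (\<bar>x\<bar> powr \<alpha>)) *\<^sub>R iexp (\<tau> * x))) (I (-\<tau>))" for \<tau>
  proof -
    have "integrable lborel (\<lambda>u. exp (of_real (u - exp (\<alpha> * u)) - \<i> * of_real (-\<tau>) * of_real (exp u)))"
      by (rule Bochner_Integration.integrable_bound[OF integrable_exp_minus_exp_mult[OF \<alpha>]]) auto
    then have "has_bochner_integral lborel
        (\<lambda>u. exp (of_real (u - exp (\<alpha> * u)) - \<i> * of_real (-\<tau>) * of_real (exp u))) (I (-\<tau>))"
      by (simp add: has_bochner_integral_iff I_def)
    also have "(\<lambda>u. exp (of_real (u - exp (\<alpha> * u)) - \<i> * of_real (-\<tau>) * of_real (exp u))) =
        (\<lambda>u. exp u *\<^sub>R (exp (- (\<bar>exp u\<bar> powr \<alpha>)) *\<^sub>R iexp (\<tau> * exp u)))"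
      by (simp add: fun_eq_iff scaleR_conv_of_real powr_def exp_of_real[symmetric] mult_exp_exp algebra_simps)
    finally show ?thesis
      by (subst (asm) has_bochner_integral_exp_substitution) measurable
  qed
  have "has_bochner_integral lborel ?g (I (-\<tau>) + I \<tau>)"
    using half[of \<tau>] half[of "-\<tau>"] by (intro has_bochner_integral_half_lines) auto
  then have "(\<integral>x. ?g x \<partial>lborel) = I \<tau> + I (-\<tau>)"
    by (simp add: has_bochner_integral_iff)
  also have "\<dots> = of_real (1 / (pi * \<alpha>)) * ((\<integral>y. G \<tau> y \<partial>lborel) + (\<integral>y. G (-\<tau>) y \<partial>lborel))"
    using integral_exp_minus_exp_mult_Fourier[OF \<alpha> c, of \<tau>]
      integral_exp_minus_exp_mult_Fourier[OF \<alpha> c, of "-\<tau>"] \<tau>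
    by (simp only: I_def G_def distrib_left) simp
  also have "(\<integral>y. G \<tau> y \<partial>lborel) + (\<integral>y. G (-\<tau>) y \<partial>lborel) = (\<integral>y. G \<tau> y + G (-\<tau>) y \<partial>lborel)"
  proof (rule Bochner_Integration.integral_add[symmetric])
    obtain w where w: "integrable lborel w"
      "\<And>p y. Re p \<ge> 0 \<Longrightarrow> norm p \<ge> \<bar>\<tau>\<bar> \<Longrightarrow>
       norm (Gamma ((1 - 2 * Complex c y) / of_real \<alpha>) * Gamma (2 * Complex c y) *
         p powr (- (2 * Complex c y))) \<le> w y"
      using norm_Gamma_Gamma_powr_bound[OF \<alpha> c, of "\<bar>\<tau>\<bar>"] \<tau> by auto
    have "integrable lborel (G \<tau>')" if "\<bar>\<tau>'\<bar> = \<bar>\<tau>\<bar>" for \<tau>'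
    proof (rule Bochner_Integration.integrable_bound[OF w(1)])
      have "\<tau>' \<noteq> 0" using \<tau> that by auto
      then have "(\<lambda>y. (\<i> * of_real \<tau>') powr (- (2 * Complex c y))) =
          (\<lambda>y. exp (- (2 * Complex c y) * Ln (\<i> * of_real \<tau>')))"
        by (simp add: powr_def)
      moreover have "continuous_on UNIV (\<lambda>y. exp (- (2 * Complex c y) * Ln (\<i> * of_real \<tau>')))"
        by (intro continuous_intros)
      ultimately have "continuous_on UNIV (\<lambda>y. (\<i> * of_real \<tau>') powr (- (2 * Complex c y)))"
        by (simp only:)
      moreover have "continuous_on UNIV (\<lambda>y. Gamma ((1 - 2 * Complex c y) / of_real \<alpha>))"
        using \<alpha> c by (intro continuous_on_Gamma_vertical continuous_intros) auto
      moreover have "continuous_on UNIV (\<lambda>y. Gamma (2 * Complex c y))"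
        using c by (intro continuous_on_Gamma_vertical continuous_intros) auto
      ultimately have "continuous_on UNIV (G \<tau>')"
        unfolding G_def by (intro continuous_on_mult)
      then show "G \<tau>' \<in> borel_measurable lborel"
        using borel_measurable_continuous_onI by simp
      have "norm (G \<tau>' y) \<le> norm (w y)" for y
        using w(2)[of "\<i> * of_real \<tau>'" y] that unfolding G_def
        by (intro order_trans[OF w(2)]) (auto simp: norm_mult)
      then show "AE y in lborel. norm (G \<tau>' y) \<le> norm (w y)" by simp
    qed
    then show "integrable lborel (G \<tau>)" "integrable lborel (G (-\<tau>))" by auto
  qed
  also have "(\<lambda>y. G \<tau> y + G (-\<tau>) y) = (\<lambda>y. of_real (sqrt pi) *
      (fox_H_kernel 1 1 [(1 - 1 / \<alpha>, 2 / \<alpha>)] [(0, 1), (1/2, 1)] (Complex c y) *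
       complex_of_real (\<tau>\<^sup>2 / 4) powr (- Complex c y)))"
  proof
    fix y
    define s where "s = Complex c y"
    have s: "0 < Re s" "Re s < 1 / 2" using c by (auto simp: s_def)
    \<comment> \<open>The argument is the square of \<open>\<bar>\<tau>\<bar> / 2\<close>, which
      matches the exponent \<open>- (2 * s)\<close> in \<open>G\<close>.\<close>
    have ln_z: "ln (\<tau>\<^sup>2 / 4) = 2 * ln \<bar>\<tau>\<bar> - 2 * ln 2"
    proof -
      have "ln (\<tau>\<^sup>2 / 4) = ln ((\<bar>\<tau>\<bar> / 2) ^ 2)" by (simp add: power_divide)
      also have "\<dots> = 2 * ln (\<bar>\<tau>\<bar> / 2)" using \<tau> by (subst ln_realpow) auto
      finally show ?thesis using \<tau> by (simp add: ln_div)
    qed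
    have z: "complex_of_real (\<tau>\<^sup>2 / 4) powr (- s) =
        exp (- (2 * s) * of_real (ln \<bar>\<tau>\<bar>)) * exp (2 * s * of_real (ln 2))"
    proof -
      have "complex_of_real (\<tau>\<^sup>2 / 4) powr (- s) = exp (- s * of_real (ln (\<tau>\<^sup>2 / 4)))"
        using \<tau> Ln_of_real[of "\<tau>\<^sup>2 / 4"] by (simp add: powr_def)
      then show ?thesis
        by (simp add: ln_z mult_exp_exp algebra_simps)
    qed
    \<comment> \<open>The power of 2 from duplication meets the one from the denominator 4; what
      remains is the 2 in front of the cosine.\<close>
    have two: "exp ((1 - 2 * s) * of_real (ln 2)) * exp (2 * s * of_real (ln 2)) = 2"
    proof -
      have "exp ((1 - 2 * s) * of_real (ln 2)) * exp (2 * s * of_real (ln 2)) = exp (complex_of_real (ln 2))"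
        by (simp add: mult_exp_exp algebra_simps)
      then show ?thesis by (simp only: exp_of_real) simp
    qed
    have "of_real (sqrt pi) * (fox_H_kernel 1 1 [(1 - 1 / \<alpha>, 2 / \<alpha>)] [(0, 1), (1/2, 1)] s *
        complex_of_real (\<tau>\<^sup>2 / 4) powr (- s)) =
      Gamma ((1 - 2 * s) / of_real \<alpha>) * Gamma (2 * s) *
        ((exp ((1 - 2 * s) * of_real (ln 2)) * exp (2 * s * of_real (ln 2))) * cos (of_real pi * s) *
         exp (- (2 * s) * of_real (ln \<bar>\<tau>\<bar>)))"
      unfolding fox_H_kernel_eq z Gamma_ratio_eq_cos[OF s] by simp
    also have "\<dots> = G \<tau> y + G (-\<tau>) y"
      unfolding two powr_ii_plus_powr_minus_ii[OF \<tau>, symmetric] G_def s_def[symmetric]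
      by (rule distrib_left)
    finally show "G \<tau> y + G (-\<tau>) y = of_real (sqrt pi) *
      (fox_H_kernel 1 1 [(1 - 1 / \<alpha>, 2 / \<alpha>)] [(0, 1), (1/2, 1)] (Complex c y) *
       complex_of_real (\<tau>\<^sup>2 / 4) powr (- Complex c y))"
      by (simp only: s_def)
  qed
  \<comment> \<open>The constants agree because \<open>sqrt pi / (pi * \<alpha>)\<close> is
    \<open>2 * sqrt pi / \<alpha>\<close> times the factor \<open>1 / (2 * pi)\<close> in
    \<open>fox_H\<close>.\<close>
  also have "of_real (1 / (pi * \<alpha>)) * (\<integral>y. of_real (sqrt pi) *
      (fox_H_kernel 1 1 [(1 - 1 / \<alpha>, 2 / \<alpha>)] [(0, 1), (1/2, 1)] (Complex c y) *
       complex_of_real (\<tau>\<^sup>2 / 4) powr (- Complex c y)) \<partial>lborel) =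
    of_real (2 * sqrt pi / \<alpha>) * fox_H 1 1 [(1 - 1 / \<alpha>, 2 / \<alpha>)] [(0, 1), (1/2, 1)] c (\<tau>\<^sup>2 / 4)"
    unfolding integral_mult_right_zero fox_H_def using \<alpha> by (simp add: field_simps)
  finally show ?thesis .
qed

text \<open>Every line with \<open>0 < c < 1/2\<close> is an admissible contour: the poles of
  \<open>Gamma s\<close> lie at 0, -1, -2 and so on, those of
  \<open>Gamma ((1 - 2 * s) / \<alpha>)\<close> at \<open>(1 + k * \<alpha>) / 2\<close> for natural
  \<open>k\<close>.\<close>

theorem theorem1:
  fixes \<alpha> \<mu> \<sigma> t c :: real and M :: "'a measure" and X :: "'a \<Rightarrow> real"
  assumes "\<alpha> > 0" and "\<sigma> > 0"
    and "prob_space M"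
    and "distributed M lborel X (\<lambda>x. ennreal (ggd_density \<mu> \<sigma> \<alpha> x))"
    and "t \<noteq> 0"
    and "0 < c" and "c < 1/2"
  shows "prob_space.expectation M (\<lambda>\<omega>. exp (\<i> * complex_of_real (t * X \<omega>)))
    = complex_of_real (sqrt pi / Gamma (1 / \<alpha>)) * exp (\<i> * complex_of_real (t * \<mu>))
      * fox_H 1 1 [(1 - 1 / \<alpha>, 2 / \<alpha>)] [(0, 1), (1/2, 1)] c
          (\<sigma>\<^sup>2 * Gamma (1 / \<alpha>) / (4 * Gamma (3 / \<alpha>)) * t\<^sup>2)"
proof -
  define \<Lambda> where "\<Lambda> = ggd_Lambda \<sigma> \<alpha>"
  have Gamma_pos: "Gamma (1 / \<alpha>) > 0" "Gamma (3 / \<alpha>) > 0"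
    using \<open>\<alpha> > 0\<close> by (simp_all add: Gamma_real_pos)
  have \<Lambda>: "\<Lambda> > 0"
    using Gamma_pos \<open>\<sigma> > 0\<close> by (simp add: \<Lambda>_def ggd_Lambda_def)
  define K where "K = \<alpha> * \<Lambda> / (2 * Gamma (1 / \<alpha>))"
  let ?H = "fox_H 1 1 [(1 - 1 / \<alpha>, 2 / \<alpha>)] [(0, 1), (1/2, 1)] c"
  have density_eq: "ggd_density \<mu> \<sigma> \<alpha> x = K * exp (- (\<bar>\<Lambda> * (x - \<mu>)\<bar> powr \<alpha>))" for x
    using \<Lambda> by (simp add: ggd_density_def K_def \<Lambda>_def[symmetric] abs_mult powr_mult)
  have [measurable]: "X \<in> borel_measurable M"
    using distributed_measurable[OF assms(4)] by simp
  have [measurable]: "ggd_density \<mu> \<sigma> \<alpha> \<in> borel_measurable borel"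
    unfolding density_eq[abs_def] by measurable
  have "K \<ge> 0" using \<open>\<alpha> > 0\<close> \<Lambda> Gamma_pos by (simp add: K_def)
  \<comment> \<open>Passing to \<open>ennreal\<close> truncates negative values, so nonnegativity is
    what recovers the density in the integral.\<close>
  then have nonneg: "ggd_density \<mu> \<sigma> \<alpha> x \<ge> 0" for x
    by (simp add: density_eq)
  have "prob_space.expectation M (\<lambda>\<omega>. iexp (t * X \<omega>)) = (\<integral>x. iexp (t * x) \<partial>distr M lborel X)"
    by (subst integral_distr) auto
  also have "\<dots> = (\<integral>x. ggd_density \<mu> \<sigma> \<alpha> x *\<^sub>R iexp (t * x) \<partial>lborel)"
    unfolding distributed_distr_eq_density[OF assms(4)]
    by (subst integral_density) (auto simp: nonneg)
  \<comment> \<open>Centring at \<mu> and scaling by \<open>1 / \<Lambda>\<close> normalizes the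
    exponent and changes the frequency to \<open>t / \<Lambda>\<close>.\<close>
  also have "\<dots> = \<bar>1 / \<Lambda>\<bar> *\<^sub>R (\<integral>x. ggd_density \<mu> \<sigma> \<alpha> (\<mu> + 1 / \<Lambda> * x) *\<^sub>R iexp (t * (\<mu> + 1 / \<Lambda> * x)) \<partial>lborel)"
    using \<Lambda> by (intro lborel_integral_real_affine) auto
  also have "(\<lambda>x. ggd_density \<mu> \<sigma> \<alpha> (\<mu> + 1 / \<Lambda> * x) *\<^sub>R iexp (t * (\<mu> + 1 / \<Lambda> * x))) =
      (\<lambda>x. (of_real K * iexp (t * \<mu>)) * (exp (- (\<bar>x\<bar> powr \<alpha>)) *\<^sub>R iexp (t / \<Lambda> * x)))"
    using \<Lambda> by (simp add: fun_eq_iff density_eq scaleR_conv_of_real ring_distribs exp_add mult_ac)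
  also have "\<bar>1 / \<Lambda>\<bar> *\<^sub>R integral\<^sup>L lborel \<dots> =
      of_real (1 / \<Lambda> * K * (2 * sqrt pi / \<alpha>)) * iexp (t * \<mu>) * ?H ((t / \<Lambda>)\<^sup>2 / 4)"
    using \<Lambda> \<open>t \<noteq> 0\<close>
    unfolding integral_mult_right_zero
    by (subst integral_exp_minus_abs_powr_iexp[OF assms(1,6,7)]) (auto simp: scaleR_conv_of_real)
  also have "1 / \<Lambda> * K * (2 * sqrt pi / \<alpha>) = sqrt pi / Gamma (1 / \<alpha>)"
    using \<Lambda> \<open>\<alpha> > 0\<close> by (simp add: K_def)
  also have "(t / \<Lambda>)\<^sup>2 / 4 = \<sigma>\<^sup>2 * Gamma (1 / \<alpha>) / (4 * Gamma (3 / \<alpha>)) * t\<^sup>2"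
    using Gamma_pos \<open>\<sigma> > 0\<close>
    by (simp add: \<Lambda>_def ggd_Lambda_def power_divide power_mult_distrib real_sqrt_pow2 field_simps)
  finally show ?thesis .
qed

end
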